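(* Let $q\ge 27$ be a prime power with $q\equiv 3\pmod 4$, let $\xi$ be a primitive element of $F_q$, $P=(0,1,0)$, $Z=(1,0,-1)$. For an integer $\overline{J}$ let $\mathcal{Q}_{\overline{J}}=\{P,Z\}\cup\{(1,\xi^d,\xi^{2d}): d=0,1,\dots,\overline{J}\}$, and let $\overline{J}_q$ be the smallest integer $\overline{J}$ such that all points $(1,a,b)$ with $a\in F_q\setminus\{0\}$, $b\in F_q$, $b\ne a^2$, and all points $(0,1,b)$ with $b\in F_q\setminus\{0\}$ lie on bisecants of $\mathcal{Q}_{\overline{J}}$. Assume $\overline{J}_q\le (q-3)/2$ and let $J$ be an integer with $\max\{\overline{J}_q,(q-3)/4\}\le J\le (q-3)/2$. Then $\mathcal{E}_J=\{(1,\xi^d,\xi^{2d}): d=0,\dots,J\}\cup\{P,Z,(1,0,-\xi^{2J})\}$ is a complete arc in $PG(2,q)$.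
   Context: Points of $PG(2,q)$ are in homogeneous coordinates $(x_0,x_1,x_2)$. A bisecant of a point set is a line through two of its distinct points. An arc is a set of points no three collinear; it is complete if it is not contained in a larger arc. *)

theory Defs
  imports Complex_Main "HOL-Library.Cardinality"
begin

text \<open>
  The plane \<open>PG(2,q)\<close> over a finite field \<open>'a\<close> with \<open>q = CARD('a)\<close>. A point is the class of all
  nonzero scalar multiples of a nonzero triple; a line is the set of the points satisfying a
  nontrivial homogeneous linear equation.
\<close>

type_synonym 'a pg_point = "('a \<times> 'a \<times> 'a) set"

definition hpt :: "'a::field \<Rightarrow> 'a \<Rightarrow> 'a \<Rightarrow> 'a pg_point" where
  "hpt x0 x1 x2 = {(k * x0, k * x1, k * x2) | k. k \<noteq> 0}"

definition pg_points :: "'a::field pg_point set" where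
  "pg_points = {hpt x0 x1 x2 | x0 x1 x2. (x0, x1, x2) \<noteq> (0, 0, 0)}"

definition pg_line :: "'a::field \<Rightarrow> 'a \<Rightarrow> 'a \<Rightarrow> 'a pg_point set" where
  "pg_line u0 u1 u2 =
     {hpt x0 x1 x2 | x0 x1 x2. (x0, x1, x2) \<noteq> (0, 0, 0) \<and> u0 * x0 + u1 * x1 + u2 * x2 = 0}"

definition pg_lines :: "'a::field pg_point set set" where
  "pg_lines = {pg_line u0 u1 u2 | u0 u1 u2. (u0, u1, u2) \<noteq> (0, 0, 0)}"

definition bisecant :: "'a::field pg_point set \<Rightarrow> 'a pg_point set \<Rightarrow> bool" where
  "bisecant S l \<longleftrightarrow> l \<in> pg_lines \<and> (\<exists>A\<in>S. \<exists>B\<in>S. A \<noteq> B \<and> A \<in> l \<and> B \<in> l)"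

definition on_bisecant :: "'a::field pg_point set \<Rightarrow> 'a pg_point \<Rightarrow> bool" where
  "on_bisecant S A \<longleftrightarrow> (\<exists>l. bisecant S l \<and> A \<in> l)"

definition pg_collinear :: "'a::field pg_point set \<Rightarrow> bool" where
  "pg_collinear S \<longleftrightarrow> (\<exists>l\<in>pg_lines. S \<subseteq> l)"

definition arc :: "'a::field pg_point set \<Rightarrow> bool" where
  "arc K \<longleftrightarrow> K \<subseteq> pg_points \<and>
     (\<forall>A\<in>K. \<forall>B\<in>K. \<forall>C\<in>K. A \<noteq> B \<and> A \<noteq> C \<and> B \<noteq> C \<longrightarrow> \<not> pg_collinear {A, B, C})"

definition complete_arc :: "'a::field pg_point set \<Rightarrow> bool" where
  "complete_arc K \<longleftrightarrow> arc K \<and> \<not> (\<exists>K'. arc K' \<and> K \<subset> K')"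

definition primitive_element :: "'a::field \<Rightarrow> bool" where
  "primitive_element \<xi> \<longleftrightarrow> range (\<lambda>n::nat. \<xi> ^ n) = UNIV - {0}"

definition conic_part :: "'a::field \<Rightarrow> int \<Rightarrow> 'a pg_point set" where
  "conic_part \<xi> J = {hpt 1 (\<xi> ^ d) (\<xi> ^ (2 * d)) | d::nat. int d \<le> J}"

definition Q_set :: "'a::field \<Rightarrow> int \<Rightarrow> 'a pg_point set" where
  "Q_set \<xi> J = {hpt 0 1 0, hpt 1 0 (- 1)} \<union> conic_part \<xi> J"

definition Q_covers :: "'a::field \<Rightarrow> int \<Rightarrow> bool" where
  "Q_covers \<xi> J \<longleftrightarrow>
     (\<forall>a b. a \<noteq> 0 \<and> b \<noteq> a\<^sup>2 \<longrightarrow> on_bisecant (Q_set \<xi> J) (hpt 1 a b)) \<and>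
     (\<forall>b. b \<noteq> 0 \<longrightarrow> on_bisecant (Q_set \<xi> J) (hpt 0 1 b))"

text \<open>
  The minimum exists for \<open>q \<ge> 27\<close>: \<open>Q_covers\<close> fails for negative \<open>J\<close>, where only the
  line joining the two extra points is a bisecant, and holds for \<open>J = q - 2\<close>.
\<close>

definition Jbar :: "'a::field \<Rightarrow> int" where
  "Jbar \<xi> = (LEAST J. Q_covers \<xi> J)"

definition E_set :: "'a::field \<Rightarrow> int \<Rightarrow> 'a pg_point set" where
  "E_set \<xi> J =
     conic_part \<xi> J \<union> {hpt 0 1 0, hpt 1 0 (- 1), hpt 1 0 (- (\<xi> ^ (2 * nat J)))}"

end

theory Submission
  imports
    Defs
    "HOL-Analysis.Determinants"
    "HOL-Computational_Algebra.Polynomial"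
begin

text \<open>
  Write \<open>q = 2 h + 1\<close> with \<open>h\<close> odd, so that \<open>\<xi> ^ h = - 1\<close>, and parametrize the conic by
  \<open>C t = (1, t, t\<^sup>2)\<close>. The chord through \<open>C t\<close> and \<open>C s\<close> contains \<open>P\<close> iff \<open>t + s = 0\<close>, and
  \<open>(1, 0, - w)\<close> iff \<open>t * s = w\<close>; for \<open>t = \<xi> ^ d\<close>, \<open>s = \<xi> ^ e\<close> and \<open>w = 1\<close> or
  \<open>w = \<xi> ^ (2 J)\<close> these are the congruences \<open>d - e \<equiv> h\<close>, \<open>d + e \<equiv> 0\<close> and
  \<open>d + e \<equiv> 2 J\<close> modulo \<open>2 h\<close>, none of which has a solution with \<open>0 \<le> d < e \<le> J < h\<close>. The line
  through \<open>P\<close> and \<open>(1, 0, - w)\<close> meets the conic where \<open>t\<^sup>2 = - w\<close>, that is nowhere,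
  since \<open>- 1\<close> is not a square when \<open>h\<close> is odd. Hence the arc property.

  For completeness, \<open>C (\<xi> ^ d)\<close> with \<open>J < d < 2 h\<close> lies on a chord through \<open>(1, 0, - \<xi> ^ (2 J))\<close> if
  \<open>d \<le> 2 J\<close>, through \<open>P\<close> if \<open>h \<le> d \<le> h + J\<close>, and through \<open>Z\<close> if \<open>d \<ge> 2 h - J\<close>; these ranges
  are exhaustive because \<open>2 J + 1 \<ge> h\<close>. The two points on the line \<open>x1 = 0\<close> cover that line,
  and the remaining points are covered by the choice of \<open>Jbar\<close>. That \<open>Jbar\<close> is a genuine
  minimum is seen by counting: for a point off the conic and off the line \<open>x1 = 0\<close>, all but at
  most five of the parameters \<open>t\<close> are nonzero and such that the line joining the point to
  \<open>C t\<close> contains \<open>C s\<close> for some \<open>s \<notin> {0, t}\<close>.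
\<close>

section \<open>Collinearity\<close>

lemma hpt_eq_iff:
  fixes a0 a1 a2 b0 b1 b2 :: "'a::field"
  shows "hpt a0 a1 a2 = hpt b0 b1 b2 \<longleftrightarrow>
    (\<exists>k. k \<noteq> 0 \<and> a0 = k * b0 \<and> a1 = k * b1 \<and> a2 = k * b2)"
proof
  assume "hpt a0 a1 a2 = hpt b0 b1 b2"
  moreover have "(1 * a0, 1 * a1, 1 * a2) \<in> hpt a0 a1 a2"
    unfolding hpt_def using one_neq_zero by blast
  ultimately have "(a0, a1, a2) \<in> hpt b0 b1 b2" by simp
  then show "\<exists>k. k \<noteq> 0 \<and> a0 = k * b0 \<and> a1 = k * b1 \<and> a2 = k * b2"
    unfolding hpt_def by auto
next
  assume "\<exists>k. k \<noteq> 0 \<and> a0 = k * b0 \<and> a1 = k * b1 \<and> a2 = k * b2"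
  then obtain k where k: "k \<noteq> 0" "a0 = k * b0" "a1 = k * b1" "a2 = k * b2" by blast
  have "\<exists>i. (j * a0, j * a1, j * a2) = (i * b0, i * b1, i * b2) \<and> i \<noteq> 0" if "j \<noteq> 0" for j
    using that k by (intro exI[of _ "j * k"]) (simp add: mult.assoc)
  moreover have "\<exists>i. (j * b0, j * b1, j * b2) = (i * a0, i * a1, i * a2) \<and> i \<noteq> 0"
    if "j \<noteq> 0" for j
    using that k by (intro exI[of _ "j / k"]) simp
  ultimately show "hpt a0 a1 a2 = hpt b0 b1 b2"
    unfolding hpt_def by blast
qed

lemma hpt_normalized_eq_iff [simp]:
  "hpt 1 a b = hpt 1 c d \<longleftrightarrow> a = c \<and> b = (d :: 'a::field)"
  "hpt 0 a b \<noteq> hpt 1 c d"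
  by (auto simp: hpt_eq_iff)

lemma hpt_in_pg_points: "(x0, x1, x2) \<noteq> (0, 0, 0) \<Longrightarrow> hpt x0 x1 x2 \<in> pg_points"
  unfolding pg_points_def by blast

lemma pg_points_cases:
  fixes X :: "'a::field pg_point"
  assumes "X \<in> pg_points"
  obtains (affine) a b where "X = hpt 1 a b" | (infinite) b where "X = hpt 0 1 b"
    | (vertical) "X = hpt 0 0 1"
proof -
  obtain x0 x1 x2 where X: "X = hpt x0 x1 x2" and nz: "(x0, x1, x2) \<noteq> (0, 0, 0)"
    using assms unfolding pg_points_def by blast
  consider (x0) "x0 \<noteq> 0" | (x1) "x0 = 0" "x1 \<noteq> 0" | (x2) "x0 = 0" "x1 = 0" "x2 \<noteq> 0"
    using nz by auto
  then show ?thesis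
  proof cases
    case x0
    then have "X = hpt 1 (x1 / x0) (x2 / x0)"
      unfolding X hpt_eq_iff by (intro exI[of _ x0]) simp
    then show ?thesis by (rule affine)
  next
    case x1
    then have "X = hpt 0 1 (x2 / x1)"
      unfolding X hpt_eq_iff by (intro exI[of _ x1]) simp
    then show ?thesis by (rule infinite)
  next
    case x2
    then have "X = hpt 0 0 1"
      unfolding X hpt_eq_iff by (intro exI[of _ x2]) simp
    then show ?thesis by (rule vertical)
  qed
qed

lemma hpt_in_pg_line_iff:
  fixes x0 x1 x2 :: "'a::field"
  assumes "(x0, x1, x2) \<noteq> (0, 0, 0)"
  shows "hpt x0 x1 x2 \<in> pg_line u0 u1 u2 \<longleftrightarrow> u0 * x0 + u1 * x1 + u2 * x2 = 0"
proof
  assume "hpt x0 x1 x2 \<in> pg_line u0 u1 u2"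
  then obtain y0 y1 y2 where "hpt x0 x1 x2 = hpt y0 y1 y2"
    and y: "u0 * y0 + u1 * y1 + u2 * y2 = 0"
    unfolding pg_line_def by blast
  then obtain k where "x0 = k * y0" "x1 = k * y1" "x2 = k * y2"
    unfolding hpt_eq_iff by blast
  then have "u0 * x0 + u1 * x1 + u2 * x2 = k * (u0 * y0 + u1 * y1 + u2 * y2)"
    by (simp add: algebra_simps)
  then show "u0 * x0 + u1 * x1 + u2 * x2 = 0" using y by simp
next
  assume "u0 * x0 + u1 * x1 + u2 * x2 = 0"
  then show "hpt x0 x1 x2 \<in> pg_line u0 u1 u2"
    unfolding pg_line_def using assms by blast
qed

lemma pg_collinear_iff_subset_pg_line:
  "pg_collinear S \<longleftrightarrow> (\<exists>u0 u1 u2. (u0, u1, u2) \<noteq> (0, 0, 0) \<and> S \<subseteq> pg_line u0 u1 u2)"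
  unfolding pg_collinear_def pg_lines_def by blast

lemma det_eq_0_iff_nontrivial_kernel:
  fixes A :: "'a::field^'n^'n"
  shows "det A = 0 \<longleftrightarrow> (\<exists>u. u \<noteq> 0 \<and> A *v u = 0)"
proof -
  have "det A = 0 \<longleftrightarrow> \<not> invertible A" by (simp add: invertible_det_nz)
  then show ?thesis unfolding invertible_left_inverse matrix_left_invertible_ker by blast
qed

lemma pg_collinear_hpt_iff_det:
  fixes a0 a1 a2 b0 b1 b2 c0 c1 c2 :: "'a::field"
  assumes "(a0, a1, a2) \<noteq> (0, 0, 0)" "(b0, b1, b2) \<noteq> (0, 0, 0)" "(c0, c1, c2) \<noteq> (0, 0, 0)"
  shows "pg_collinear {hpt a0 a1 a2, hpt b0 b1 b2, hpt c0 c1 c2} \<longleftrightarrow>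
    det (vector [vector [a0, a1, a2], vector [b0, b1, b2], vector [c0, c1, c2]] :: 'a^3^3) = 0"
    (is "_ \<longleftrightarrow> det ?A = 0")
proof -
  have "pg_collinear {hpt a0 a1 a2, hpt b0 b1 b2, hpt c0 c1 c2} \<longleftrightarrow>
    (\<exists>u0 u1 u2. (u0, u1, u2) \<noteq> (0, 0, 0) \<and> u0 * a0 + u1 * a1 + u2 * a2 = 0 \<and>
      u0 * b0 + u1 * b1 + u2 * b2 = 0 \<and> u0 * c0 + u1 * c1 + u2 * c2 = 0)"
    unfolding pg_collinear_iff_subset_pg_line
    using assms by (simp add: hpt_in_pg_line_iff)
  also have "\<dots> \<longleftrightarrow> (\<exists>u0 u1 u2. (vector [u0, u1, u2] :: 'a^3) \<noteq> 0 \<and> ?A *v vector [u0, u1, u2] = 0)"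
    by (simp add: vec_eq_iff forall_3 matrix_vector_mult_def sum_3 mult.commute)
  also have "\<dots> \<longleftrightarrow> (\<exists>u. u \<noteq> 0 \<and> ?A *v u = 0)"
    using forall_vector_3[of "\<lambda>u. \<not> (u \<noteq> 0 \<and> ?A *v u = 0)"] by blast
  finally show ?thesis unfolding det_eq_0_iff_nontrivial_kernel .
qed

lemma on_bisecant_iff_pg_collinear:
  "on_bisecant S X \<longleftrightarrow> (\<exists>A\<in>S. \<exists>B\<in>S. A \<noteq> B \<and> pg_collinear {A, B, X})"
  unfolding on_bisecant_def bisecant_def pg_collinear_def by auto

lemma on_bisecantI:
  "A \<in> S \<Longrightarrow> B \<in> S \<Longrightarrow> A \<noteq> B \<Longrightarrow> pg_collinear {A, B, X} \<Longrightarrow> on_bisecant S X"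
  unfolding on_bisecant_iff_pg_collinear by blast

section \<open>Arcs\<close>

lemma arc_insert:
  assumes "arc K" "X \<in> pg_points" "pairwise (\<lambda>A B. \<not> pg_collinear {X, A, B}) K"
  shows "arc (insert X K)"
proof -
  have not_collinear_X: "\<not> pg_collinear {X, A, B}" if "A \<in> K" "B \<in> K" "A \<noteq> B" for A B
    using assms(3) that unfolding pairwise_def by blast
  have K_points: "K \<subseteq> pg_points" using assms(1) unfolding arc_def by blast
  have "\<not> pg_collinear {A, B, C}"
    if mem: "A \<in> insert X K" "B \<in> insert X K" "C \<in> insert X K"
      and neq: "A \<noteq> B" "A \<noteq> C" "B \<noteq> C" for A B C
  proof -
    consider (A) "A = X" "B \<in> K" "C \<in> K" | (B) "B = X" "A \<in> K" "C \<in> K"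
      | (C) "C = X" "A \<in> K" "B \<in> K" | (none) "A \<in> K" "B \<in> K" "C \<in> K"
      using mem neq by auto
    then show ?thesis
    proof cases
      case A
      with not_collinear_X[of B C] neq show ?thesis by simp
    next
      case B
      with not_collinear_X[of A C] neq show ?thesis by (simp add: insert_commute)
    next
      case C
      with not_collinear_X[of A B] neq show ?thesis by (simp add: insert_commute)
    next
      case none
      with assms(1) neq show ?thesis unfolding arc_def by blast
    qed
  qed
  then show ?thesis
    using K_points assms(2) unfolding arc_def insert_subset by (intro conjI ballI impI; blast)
qed

lemma pairwise_not_pg_collinear_insert:
  "pairwise (\<lambda>A B. \<not> pg_collinear {X, A, B}) (insert Y K) \<longleftrightarrow>
     (\<forall>A\<in>K. A \<noteq> Y \<longrightarrow> \<not> pg_collinear {X, Y, A}) \<and> pairwise (\<lambda>A B. \<not> pg_collinear {X, A, B}) K"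
proof -
  have "{X, A, Y} = {X, Y, A}" for A by blast
  then show ?thesis unfolding pairwise_insert by auto
qed

lemma complete_arcI:
  assumes "arc K" "\<And>X. X \<in> pg_points \<Longrightarrow> X \<notin> K \<Longrightarrow> on_bisecant K X"
  shows "complete_arc K"
proof -
  have False if "arc K'" "K \<subset> K'" for K'
  proof -
    obtain X where X: "X \<in> K'" "X \<notin> K" using \<open>K \<subset> K'\<close> by blast
    then have "X \<in> pg_points" using \<open>arc K'\<close> unfolding arc_def by blast
    then obtain A B where "A \<in> K" "B \<in> K" "A \<noteq> B" "pg_collinear {A, B, X}"
      using assms(2) X(2) unfolding on_bisecant_iff_pg_collinear by blast
    then show False
      using \<open>arc K'\<close> \<open>K \<subset> K'\<close> X unfolding arc_def by (metis psubsetE subsetD)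
  qed
  with assms(1) show ?thesis unfolding complete_arc_def by blast
qed

section \<open>The conic\<close>

definition conic_point :: "'a::field \<Rightarrow> 'a pg_point" where
  "conic_point t = hpt 1 t (t\<^sup>2)"

lemma conic_point_eq_iff [simp]: "conic_point t = conic_point s \<longleftrightarrow> t = s"
  unfolding conic_point_def by auto

lemma hpt_neq_conic_point [simp]:
  "hpt 0 a b \<noteq> conic_point t"
  "t \<noteq> a \<Longrightarrow> hpt 1 a b \<noteq> conic_point t"
  unfolding conic_point_def by simp_all

lemma pg_collinear_point_conic_chord_iff:
  fixes t s x0 x1 x2 :: "'a::field"
  assumes "(x0, x1, x2) \<noteq> (0, 0, 0)"
  shows "pg_collinear {hpt x0 x1 x2, conic_point t, conic_point s} \<longleftrightarrow>
    t = s \<or> x2 + t * s * x0 = (t + s) * x1"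
proof -
  have "det (vector [vector [x0, x1, x2], vector [1, t, t\<^sup>2], vector [1, s, s\<^sup>2]] :: 'a^3^3) =
      (s - t) * (x2 + t * s * x0 - (t + s) * x1)"
    by (simp add: det_3 algebra_simps power2_eq_square)
  with assms show ?thesis
    unfolding conic_point_def by (auto simp: pg_collinear_hpt_iff_det)
qed

lemma pg_collinear_axis_iff:
  fixes v w x0 x1 x2 :: "'a::field"
  assumes "(x0, x1, x2) \<noteq> (0, 0, 0)"
  shows "pg_collinear {hpt 1 0 v, hpt 1 0 w, hpt x0 x1 x2} \<longleftrightarrow> v = w \<or> x1 = 0"
proof -
  have "det (vector [vector [1, 0, v], vector [1, 0, w], vector [x0, x1, x2]] :: 'a^3^3) =
      (v - w) * x1"
    by (simp add: det_3 algebra_simps power2_eq_square)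
  with assms show ?thesis by (simp add: pg_collinear_hpt_iff_det)
qed

lemma pg_collinear_axis_010_iff:
  fixes v x0 x1 x2 :: "'a::field"
  assumes "(x0, x1, x2) \<noteq> (0, 0, 0)"
  shows "pg_collinear {hpt 1 0 v, hpt 0 1 0, hpt x0 x1 x2} \<longleftrightarrow> x2 = v * x0"
proof -
  have "det (vector [vector [1, 0, v], vector [0, 1, 0], vector [x0, x1, x2]] :: 'a^3^3) =
      x2 - v * x0"
    by (simp add: det_3 algebra_simps)
  with assms show ?thesis by (simp add: pg_collinear_hpt_iff_det)
qed

lemma arc_conic:
  fixes T :: "'a::field set"
  shows "arc (conic_point ` T)"
proof -
  have "\<not> pg_collinear {conic_point r, conic_point t, conic_point s}"
    if "r \<noteq> t" "r \<noteq> s" "t \<noteq> s" for r s t :: 'a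
  proof -
    have "(r - t) * (r - s) \<noteq> 0" using that by simp
    then have "r\<^sup>2 + t * s * 1 \<noteq> (t + s) * r"
      by (simp add: algebra_simps power2_eq_square)
    then show ?thesis
      using \<open>t \<noteq> s\<close> by (simp add: conic_point_def[of r] pg_collinear_point_conic_chord_iff)
  qed
  moreover have "conic_point t \<in> pg_points" for t :: 'a
    unfolding conic_point_def by (rule hpt_in_pg_points) simp
  ultimately show ?thesis unfolding arc_def by (simp add: image_subset_iff)
qed

definition conic_extension :: "'a::field set \<Rightarrow> 'a \<Rightarrow> 'a \<Rightarrow> 'a pg_point set" where
  "conic_extension T v w =
     insert (hpt 1 0 (- w)) (insert (hpt 1 0 (- v)) (insert (hpt 0 1 0) (conic_point ` T)))"

lemma arc_conic_extension:
  fixes T :: "'a::field set"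
  assumes "v \<noteq> w"
    and sum: "\<And>t s. t \<in> T \<Longrightarrow> s \<in> T \<Longrightarrow> t + s \<noteq> 0"
    and prod: "\<And>t s. t \<in> T \<Longrightarrow> s \<in> T \<Longrightarrow> t \<noteq> s \<Longrightarrow> t * s \<notin> {v, w}"
    and square: "\<And>t. t \<in> T \<Longrightarrow> t\<^sup>2 \<notin> {- v, - w}"
  shows "arc (conic_extension T v w)"
proof -
  let ?P = "hpt 0 1 (0 :: 'a)" and ?V = "hpt 1 0 (- v)" and ?W = "hpt 1 0 (- w)"
  let ?C = "conic_point ` T"
  have "0 \<notin> T" using sum[of 0 0] by auto
  have pairwise_conic: "pairwise (\<lambda>A B. \<not> pg_collinear {hpt x0 x1 x2, A, B}) ?C"
    if "(x0, x1, x2) \<noteq> (0, 0, 0)"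
      and "\<And>t s. t \<in> T \<Longrightarrow> s \<in> T \<Longrightarrow> t \<noteq> s \<Longrightarrow> x2 + t * s * x0 \<noteq> (t + s) * x1" for x0 x1 x2
    using that by (auto simp: pairwise_def pg_collinear_point_conic_chord_iff)
  have pairwise_axis: "pairwise (\<lambda>A B. \<not> pg_collinear {hpt 1 0 (- x), A, B}) (insert ?P ?C)"
    if "x \<in> {v, w}" for x
  proof -
    have "- x + t * s * 1 \<noteq> (t + s) * 0" if "t \<in> T" "s \<in> T" "t \<noteq> s" for t s
      using prod[OF that] \<open>x \<in> {v, w}\<close> by auto
    moreover have "\<not> pg_collinear {hpt 1 0 (- x), ?P, conic_point t}" if "t \<in> T" for t
      using square[OF that] \<open>x \<in> {v, w}\<close> by (auto simp: pg_collinear_axis_010_iff conic_point_def)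
    ultimately show ?thesis
      unfolding pairwise_not_pg_collinear_insert by (auto intro: pairwise_conic)
  qed
  have "\<not> pg_collinear {?W, ?V, A}" if "A \<in> insert ?P ?C" for A
    using that \<open>v \<noteq> w\<close> \<open>0 \<notin> T\<close> by (auto simp: pg_collinear_axis_iff conic_point_def)
  then have pairwise_W: "pairwise (\<lambda>A B. \<not> pg_collinear {?W, A, B}) (insert ?V (insert ?P ?C))"
    unfolding pairwise_not_pg_collinear_insert[of ?W ?V] using pairwise_axis[of w] by blast
  have "arc (insert ?P ?C)"
    by (rule arc_insert[OF arc_conic hpt_in_pg_points pairwise_conic]) (use sum in auto)
  then have "arc (insert ?V (insert ?P ?C))"
    by (rule arc_insert[OF _ hpt_in_pg_points pairwise_axis]) auto
  then show ?thesis
    unfolding conic_extension_def by (rule arc_insert[OF _ hpt_in_pg_points pairwise_W]) simp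
qed

lemma on_bisecant_if_conic_chord:
  fixes t s x0 x1 x2 :: "'a::field"
  assumes "conic_point t \<in> S" "conic_point s \<in> S" "t \<noteq> s"
    and "(x0, x1, x2) \<noteq> (0, 0, 0)" "x2 + t * s * x0 = (t + s) * x1"
  shows "on_bisecant S (hpt x0 x1 x2)"
proof (rule on_bisecantI[OF assms(1,2)])
  have "{conic_point t, conic_point s, hpt x0 x1 x2} = {hpt x0 x1 x2, conic_point t, conic_point s}"
    by blast
  then show "pg_collinear {conic_point t, conic_point s, hpt x0 x1 x2}"
    using assms(4,5) by (simp add: pg_collinear_point_conic_chord_iff)
qed (use assms(3) in simp)

definition covers_off_conic_and_axis :: "'a::field pg_point set \<Rightarrow> bool" where
  "covers_off_conic_and_axis S \<longleftrightarrow>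
     (\<forall>a b. a \<noteq> 0 \<and> b \<noteq> a\<^sup>2 \<longrightarrow> on_bisecant S (hpt 1 a b)) \<and>
     (\<forall>b. b \<noteq> 0 \<longrightarrow> on_bisecant S (hpt 0 1 b))"

lemma covers_off_conic_and_axis_mono:
  "covers_off_conic_and_axis S \<Longrightarrow> S \<subseteq> T \<Longrightarrow> covers_off_conic_and_axis T"
  unfolding covers_off_conic_and_axis_def on_bisecant_iff_pg_collinear by (meson subsetD)

lemma on_bisecant_conic_extension_axis:
  assumes "v \<noteq> w" "(x0, x2) \<noteq> (0, 0)"
  shows "on_bisecant (conic_extension T v w) (hpt x0 0 x2)"
  using assms unfolding conic_extension_def
  by (intro on_bisecantI[of "hpt 1 0 (- v)" _ "hpt 1 0 (- w)"])
    (auto simp: pg_collinear_axis_iff)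

lemma on_bisecant_conic_extension_conic_point:
  fixes T :: "'a::field set"
  assumes "0 \<notin> T" "t \<noteq> 0" and chord: "- t \<in> T \<or> v / t \<in> T \<or> w / t \<in> T"
  shows "on_bisecant (conic_extension T v w) (conic_point t)" (is "on_bisecant ?K _")
proof -
  have collinear: ?thesis
    if "hpt x0 x1 x2 \<in> ?K" "(x0, x1, x2) \<noteq> (0, 0, 0)" "s \<in> T"
      "hpt x0 x1 x2 \<noteq> conic_point s" "x2 + s * t * x0 = (s + t) * x1" for x0 x1 x2 s
  proof (rule on_bisecantI[of "hpt x0 x1 x2" _ "conic_point s"])
    show "conic_point s \<in> ?K" using \<open>s \<in> T\<close> unfolding conic_extension_def by simp
    show "pg_collinear {hpt x0 x1 x2, conic_point s, conic_point t}"
      using that(2,5) by (simp only: pg_collinear_point_conic_chord_iff simp_thms)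
  qed (use that in simp_all)
  have extra_points: "hpt 0 1 0 \<in> ?K" "hpt 1 0 (- v) \<in> ?K" "hpt 1 0 (- w) \<in> ?K"
    unfolding conic_extension_def by simp_all
  have nonzero: "s \<noteq> 0" if "s \<in> T" for s using that \<open>0 \<notin> T\<close> by blast
  from chord show ?thesis
  proof (elim disjE)
    assume "- t \<in> T"
    then show ?thesis using extra_points(1) by (intro collinear[of 0 1 0 "- t"]) auto
  next
    assume "v / t \<in> T"
    then show ?thesis
      using extra_points(2) \<open>t \<noteq> 0\<close>
      by (intro collinear[of 1 0 "- v" "v / t"]) (auto dest: nonzero)
  next
    assume "w / t \<in> T"
    then show ?thesis
      using extra_points(3) \<open>t \<noteq> 0\<close>
      by (intro collinear[of 1 0 "- w" "w / t"]) (auto dest: nonzero)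
  qed
qed

lemma complete_arc_conic_extension:
  fixes T :: "'a::field set" and v w :: 'a
  defines "K \<equiv> conic_extension T v w"
  assumes "arc K" "v \<noteq> w" and covers: "covers_off_conic_and_axis K"
    and "0 \<notin> T" and chord: "\<And>t. t \<noteq> 0 \<Longrightarrow> t \<notin> T \<Longrightarrow> - t \<in> T \<or> v / t \<in> T \<or> w / t \<in> T"
  shows "complete_arc K"
proof (rule complete_arcI[OF \<open>arc K\<close>])
  fix X assume "X \<in> pg_points" "X \<notin> K"
  have axis: "on_bisecant K (hpt x0 0 x2)" if "(x0, x2) \<noteq> (0, 0)" for x0 x2
    unfolding K_def using \<open>v \<noteq> w\<close> that by (rule on_bisecant_conic_extension_axis)
  have conic_point: "on_bisecant K (conic_point t)" if "t \<noteq> 0" "t \<notin> T" for t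
    unfolding K_def using \<open>0 \<notin> T\<close> \<open>t \<noteq> 0\<close> chord[OF that]
    by (rule on_bisecant_conic_extension_conic_point)
  show "on_bisecant K X"
    using \<open>X \<in> pg_points\<close>
  proof (cases rule: pg_points_cases)
    case (affine a b)
    consider (zero) "a = 0" | (off_conic) "a \<noteq> 0" "b \<noteq> a\<^sup>2" | (conic) "a \<noteq> 0" "b = a\<^sup>2"
      by blast
    then show ?thesis
    proof cases
      case conic
      with \<open>X \<notin> K\<close> affine have "a \<notin> T"
        unfolding K_def conic_extension_def conic_point_def by auto
      with affine conic conic_point show ?thesis unfolding conic_point_def by simp
    qed (use affine axis covers in \<open>auto simp: covers_off_conic_and_axis_def\<close>)
  next
    case (infinite b)
    with \<open>X \<notin> K\<close> have "b \<noteq> 0" unfolding K_def conic_extension_def by auto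
    with infinite covers show ?thesis unfolding covers_off_conic_and_axis_def by simp
  next
    case vertical
    with axis[of 0 1] show ?thesis by simp
  qed
qed

section \<open>Covering by the chords of the conic\<close>

lemma degree_less_card_imp_nonroot:
  fixes p :: "'a::{idom,finite} poly"
  assumes "p \<noteq> 0" "degree p < CARD('a)"
  obtains t where "poly p t \<noteq> 0"
proof -
  have "card {t. poly p t = 0} < CARD('a)"
    using card_poly_roots_bound[OF assms(1)] assms(2) by simp
  then have "{t. poly p t = 0} \<noteq> UNIV" by auto
  then show ?thesis using that by blast
qed

lemma covers_off_conic_and_axis_if_conic_subset:
  fixes S :: "'a::{field,finite} pg_point set"
  assumes conic: "\<And>t. t \<noteq> 0 \<Longrightarrow> conic_point t \<in> S" and "CARD('a) \<ge> 6"
  shows "covers_off_conic_and_axis S"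
proof -
  have "on_bisecant S (hpt 1 a b)" if "a \<noteq> 0" "b \<noteq> a\<^sup>2" for a b
  proof -
    let ?p = "[:0, 1:] * [:- a, 1:] * [:b, - a:] * [:b, - 2 * a, 1:]"
    have "?p \<noteq> 0" "degree ?p \<le> 5" using \<open>a \<noteq> 0\<close> by (simp_all add: degree_mult_eq)
    then obtain t where "poly ?p t \<noteq> 0"
      using degree_less_card_imp_nonroot[of ?p] assms(2) by auto
    then have t_nonroot: "t \<noteq> 0" "t \<noteq> a" "b - a * t \<noteq> 0" "t\<^sup>2 - 2 * a * t + b \<noteq> 0"
      unfolding poly_mult mult_eq_0_iff de_Morgan_disj
      by (auto simp: algebra_simps power2_eq_square)
    define s where "s = (b - a * t) / (a - t)"
    have chord: "s * (a - t) = b - a * t" using t_nonroot unfolding s_def by simp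
    have "s \<noteq> 0" using t_nonroot chord by auto
    moreover have "t \<noteq> s" using t_nonroot(4) chord by algebra
    moreover have "b + t * s * 1 = (t + s) * a" using chord by algebra
    ultimately show ?thesis
      using t_nonroot(1) by (intro on_bisecant_if_conic_chord[OF conic conic, of t s]) auto
  qed
  moreover have "on_bisecant S (hpt 0 1 b)" if "b \<noteq> 0" for b
  proof -
    let ?p = "[:0, 1:] * [:b, - 1:] * [:b, - 2:]"
    have "degree [:b, - 2:] \<le> 1" by simp
    then have "?p \<noteq> 0" "degree ?p \<le> 3"
      using \<open>b \<noteq> 0\<close> degree_mult_le[of "[:0, 1:] * [:b, - 1:]" "[:b, - 2:]"]
      by (simp_all add: degree_mult_eq)
    then obtain t where "poly ?p t \<noteq> 0"
      using degree_less_card_imp_nonroot[of ?p] assms(2) by auto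
    then have "t \<noteq> 0" "b - t \<noteq> 0" "t \<noteq> b - t" by auto
    then show ?thesis
      by (intro on_bisecant_if_conic_chord[OF conic conic, of t "b - t"]) auto
  qed
  ultimately show ?thesis unfolding covers_off_conic_and_axis_def by blast
qed

section \<open>Powers of a primitive element\<close>

text \<open>
  The library lemma \<open>finite_field_power_card_eq_same\<close> does not apply: it is stated for the class
  \<open>finite_field\<close>, of which the sort \<open>{field, finite}\<close> is not known to be a subsort.
\<close>

lemma power_card_minus_one_eq_1:
  fixes x :: "'a::{field,finite}"
  assumes "x \<noteq> 0"
  shows "x ^ (CARD('a) - 1) = 1"
proof -
  have "(\<Prod>y\<in>UNIV - {0}. y) = (\<Prod>y\<in>UNIV - {0}. x * y)"
    by (rule prod.reindex_bij_witness[of _ "\<lambda>y. x * y" "\<lambda>y. y / x"]) (use assms in auto)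
  also have "\<dots> = x ^ (CARD('a) - 1) * (\<Prod>y\<in>UNIV - {0}. y)"
    by (simp add: prod.distrib card_Diff_singleton)
  finally show ?thesis by simp
qed

lemma two_le_card: "2 \<le> CARD('a::{zero_neq_one,finite})"
proof -
  have "card {0, 1 :: 'a} \<le> CARD('a)" by (rule card_mono) simp_all
  then show ?thesis by simp
qed

lemma primitive_element_nonzero:
  assumes "primitive_element \<xi>"
  shows "\<xi> \<noteq> 0"
proof -
  have "\<xi> ^ 1 \<in> UNIV - {0}"
    using assms unfolding primitive_element_def by blast
  then show ?thesis by simp
qed

lemma bij_betw_primitive_element_power:
  fixes \<xi> :: "'a::{field,finite}"
  assumes "primitive_element \<xi>"
  shows "bij_betw (\<lambda>k. \<xi> ^ k) {..<CARD('a) - 1} (- {0})"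
proof -
  let ?n = "CARD('a) - 1"
  have "?n > 0" using two_le_card[where 'a = 'a] by simp
  have "\<xi> ^ k \<in> (\<lambda>k. \<xi> ^ k) ` {..<?n}" for k
  proof (rule image_eqI[of _ _ "k mod ?n"])
    have "\<xi> ^ k = \<xi> ^ (?n * (k div ?n) + k mod ?n)" by simp
    also have "\<dots> = (\<xi> ^ ?n) ^ (k div ?n) * \<xi> ^ (k mod ?n)"
      by (simp only: power_add power_mult)
    also have "\<xi> ^ ?n = 1"
      by (rule power_card_minus_one_eq_1[OF primitive_element_nonzero[OF assms]])
    finally show "\<xi> ^ k = \<xi> ^ (k mod ?n)" by simp
    show "k mod ?n \<in> {..<?n}" using \<open>?n > 0\<close> by simp
  qed
  then have "(\<lambda>k. \<xi> ^ k) ` {..<?n} = range (\<lambda>k. \<xi> ^ k)" by blast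
  then have image: "(\<lambda>k. \<xi> ^ k) ` {..<?n} = - {0}"
    using assms by (simp add: primitive_element_def Compl_eq_Diff_UNIV)
  moreover have "card (- {0 :: 'a}) = ?n"
    by (simp add: Compl_eq_Diff_UNIV card_Diff_singleton)
  with image have "inj_on (\<lambda>k. \<xi> ^ k) {..<?n}"
    by (intro eq_card_imp_inj_on) (simp_all only: finite_lessThan card_lessThan)
  ultimately show ?thesis unfolding bij_betw_def by blast
qed

lemma primitive_element_power_inject:
  fixes \<xi> :: "'a::{field,finite}"
  assumes "primitive_element \<xi>" "i < CARD('a) - 1" "k < CARD('a) - 1"
  shows "\<xi> ^ i = \<xi> ^ k \<longleftrightarrow> i = k"
  using bij_betw_imp_inj_on[OF bij_betw_primitive_element_power[OF assms(1)]] assms(2,3)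
  by (auto dest: inj_onD)

definition initial_powers :: "'a::power \<Rightarrow> nat \<Rightarrow> 'a set" where
  "initial_powers \<xi> j = (\<lambda>d. \<xi> ^ d) ` {..j}"

context
  fixes \<xi> :: "'a::{field,finite}" and h :: nat
  assumes primitive: "primitive_element \<xi>" and card: "CARD('a) = 2 * h + 1"
begin

lemma primitive_element_power_half: "\<xi> ^ h = - 1"
proof -
  have "\<xi> ^ h \<noteq> \<xi> ^ 0"
    using primitive_element_power_inject[OF primitive, of h 0] two_le_card[where 'a = 'a] card
    by simp
  moreover have "(\<xi> ^ h)\<^sup>2 = 1"
    using power_card_minus_one_eq_1[OF primitive_element_nonzero[OF primitive]] card
    by (simp flip: power_mult add: mult.commute)
  ultimately show ?thesis unfolding power2_eq_1_iff by simp
qed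

lemma square_neq_uminus_square:
  fixes x y :: 'a
  assumes "odd h" "y \<noteq> 0"
  shows "x\<^sup>2 \<noteq> - (y\<^sup>2)"
proof
  assume eq: "x\<^sup>2 = - (y\<^sup>2)"
  have "(z\<^sup>2) ^ h = 1" if "z \<noteq> 0" for z :: 'a
    using power_card_minus_one_eq_1[OF that] card by (simp flip: power_mult)
  moreover have "x \<noteq> 0" using eq \<open>y \<noteq> 0\<close> by auto
  ultimately have "- 1 = (1 :: 'a)"
    using eq assms by (metis power_minus_odd)
  then have "\<xi> ^ h = \<xi> ^ 0" using primitive_element_power_half by simp
  then show False
    using primitive_element_power_inject[OF primitive, of h 0] card \<open>odd h\<close> by (auto elim: oddE)
qed

lemma initial_powers_add_neq_0:
  assumes "j < h" "t \<in> initial_powers \<xi> j" "s \<in> initial_powers \<xi> j"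
  shows "t + s \<noteq> 0"
proof
  obtain d e where exponents: "t = \<xi> ^ d" "s = \<xi> ^ e" "d \<le> j" "e \<le> j"
    using assms(2,3) unfolding initial_powers_def by blast
  assume "t + s = 0"
  then have "\<xi> ^ d = \<xi> ^ (h + e)"
    using exponents by (simp add: power_add primitive_element_power_half eq_neg_iff_add_eq_0)
  then show False
    using primitive_element_power_inject[OF primitive, of d "h + e"] card exponents \<open>j < h\<close> by simp
qed

lemma initial_powers_mult_notin:
  assumes "j < h" "t \<in> initial_powers \<xi> j" "s \<in> initial_powers \<xi> j" "t \<noteq> s"
  shows "t * s \<notin> {1, \<xi> ^ (2 * j)}"
proof -
  obtain d e where exponents: "t = \<xi> ^ d" "s = \<xi> ^ e" "d \<le> j" "e \<le> j"
    using assms(2,3) unfolding initial_powers_def by blast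
  moreover have "d \<noteq> e" using exponents \<open>t \<noteq> s\<close> by blast
  ultimately show ?thesis
    using primitive_element_power_inject[OF primitive, of "d + e" 0]
      primitive_element_power_inject[OF primitive, of "d + e" "2 * j"] card \<open>j < h\<close>
    by (auto simp: power_add)
qed

lemma uminus_or_divide_in_initial_powers:
  assumes "j < h" "h \<le> 2 * j + 1" "t \<noteq> 0" "t \<notin> initial_powers \<xi> j"
  shows "- t \<in> initial_powers \<xi> j \<or> 1 / t \<in> initial_powers \<xi> j \<or>
    \<xi> ^ (2 * j) / t \<in> initial_powers \<xi> j"
proof -
  have power_in: "\<xi> ^ e \<in> initial_powers \<xi> j" if "e \<le> j" for e
    using that unfolding initial_powers_def by blast
  have "t \<in> (\<lambda>k. \<xi> ^ k) ` {..<2 * h}"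
    using bij_betw_imp_surj_on[OF bij_betw_primitive_element_power[OF primitive]] \<open>t \<noteq> 0\<close> card
    by simp
  then obtain d where d: "t = \<xi> ^ d" "d < 2 * h" by blast
  with \<open>t \<notin> initial_powers \<xi> j\<close> power_in have "d > j" using not_le by blast
  then consider (w_quotient) "d \<le> 2 * j" | (negative) "h \<le> d" "d \<le> h + j"
    | (reciprocal) "2 * h - j \<le> d"
    using assms(1,2) by linarith
  then show ?thesis
  proof cases
    case w_quotient
    then have "\<xi> ^ (2 * j) = \<xi> ^ (2 * j - d) * t" using d by (simp flip: power_add)
    then have "\<xi> ^ (2 * j) / t = \<xi> ^ (2 * j - d)"
      using \<open>t \<noteq> 0\<close> by (simp add: eq_divide_eq divide_eq_eq)
    with power_in[of "2 * j - d"] \<open>d > j\<close> show ?thesis by simp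
  next
    case negative
    then have "t = \<xi> ^ h * \<xi> ^ (d - h)" using d by (simp flip: power_add)
    then have "- t = \<xi> ^ (d - h)" by (simp add: primitive_element_power_half)
    with power_in[of "d - h"] negative show ?thesis by simp
  next
    case reciprocal
    have "\<xi> ^ (2 * h - d) * t = \<xi> ^ (2 * h)" using d by (simp flip: power_add)
    also have "\<dots> = 1"
      using power_card_minus_one_eq_1[OF primitive_element_nonzero[OF primitive]] card by simp
    finally have "1 / t = \<xi> ^ (2 * h - d)" using \<open>t \<noteq> 0\<close> by (simp add: field_simps)
    with power_in[of "2 * h - d"] reciprocal show ?thesis by simp
  qed
qed

lemma arc_conic_extension_initial_powers:
  assumes "odd h" "0 < j" "j < h"
  shows "arc (conic_extension (initial_powers \<xi> j) 1 (\<xi> ^ (2 * j)))"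
proof (rule arc_conic_extension)
  show "1 \<noteq> \<xi> ^ (2 * j)"
    using primitive_element_power_inject[OF primitive, of 0 "2 * j"] card assms by simp
  show "t\<^sup>2 \<notin> {- 1, - (\<xi> ^ (2 * j))}" for t
    using square_neq_uminus_square[OF \<open>odd h\<close>, of 1 t]
      square_neq_uminus_square[OF \<open>odd h\<close>, of "\<xi> ^ j" t] primitive_element_nonzero[OF primitive]
    unfolding power_even_eq by simp
  show "t + s \<noteq> 0" if "t \<in> initial_powers \<xi> j" "s \<in> initial_powers \<xi> j" for t s
    using \<open>j < h\<close> that by (rule initial_powers_add_neq_0)
  show "t * s \<notin> {1, \<xi> ^ (2 * j)}"
    if "t \<in> initial_powers \<xi> j" "s \<in> initial_powers \<xi> j" "t \<noteq> s" for t s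
    using \<open>j < h\<close> that by (rule initial_powers_mult_notin)
qed

lemma complete_arc_conic_extension_initial_powers:
  assumes "odd h" "0 < j" "j < h" "h \<le> 2 * j + 1"
    and "covers_off_conic_and_axis (conic_extension (initial_powers \<xi> j) 1 (\<xi> ^ (2 * j)))"
  shows "complete_arc (conic_extension (initial_powers \<xi> j) 1 (\<xi> ^ (2 * j)))"
proof (rule complete_arc_conic_extension)
  show "arc (conic_extension (initial_powers \<xi> j) 1 (\<xi> ^ (2 * j)))"
    using assms(1-3) by (rule arc_conic_extension_initial_powers)
  show "1 \<noteq> \<xi> ^ (2 * j)"
    using primitive_element_power_inject[OF primitive, of 0 "2 * j"] card assms(2,3) by simp
  show "0 \<notin> initial_powers \<xi> j"
    using primitive_element_nonzero[OF primitive] unfolding initial_powers_def by auto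
  show "- t \<in> initial_powers \<xi> j \<or> 1 / t \<in> initial_powers \<xi> j \<or>
      \<xi> ^ (2 * j) / t \<in> initial_powers \<xi> j"
    if "t \<noteq> 0" "t \<notin> initial_powers \<xi> j" for t
    using \<open>j < h\<close> \<open>h \<le> 2 * j + 1\<close> that by (rule uminus_or_divide_in_initial_powers)
qed (rule assms(5))

end

section \<open>The minimum defining Jbar\<close>

lemma conic_part_of_nat:
  "conic_part \<xi> (int j) = conic_point ` initial_powers \<xi> j"
  unfolding conic_part_def conic_point_def initial_powers_def by (auto simp: image_iff power_even_eq)

lemma E_set_of_nat:
  "E_set \<xi> (int j) = conic_extension (initial_powers \<xi> j) 1 (\<xi> ^ (2 * j))"
  unfolding E_set_def conic_extension_def conic_part_of_nat by auto

lemma Q_set_subset_E_set: "i \<le> J \<Longrightarrow> Q_set \<xi> i \<subseteq> E_set \<xi> J"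
  unfolding Q_set_def E_set_def conic_part_def by auto

lemma Q_covers_iff: "Q_covers \<xi> J \<longleftrightarrow> covers_off_conic_and_axis (Q_set \<xi> J)"
  unfolding Q_covers_def covers_off_conic_and_axis_def ..

lemma Q_covers_imp_nonneg:
  fixes \<xi> :: "'a::field"
  assumes "Q_covers \<xi> J"
  shows "0 \<le> J"
proof (rule ccontr)
  assume "\<not> 0 \<le> J"
  then have "Q_set \<xi> J = {hpt 0 1 0, hpt 1 0 (- 1)}"
    unfolding Q_set_def conic_part_def by auto
  moreover have "on_bisecant (Q_set \<xi> J) (hpt 0 1 1)"
    using assms unfolding Q_covers_def by simp
  ultimately have "pg_collinear {hpt 1 0 (- 1), hpt 0 1 0, hpt 0 1 (1 :: 'a)}"
    unfolding on_bisecant_iff_pg_collinear by (auto simp: insert_commute)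
  then show False by (simp add: pg_collinear_axis_010_iff)
qed

lemma Q_covers_CARD:
  fixes \<xi> :: "'a::{field,finite}"
  assumes "primitive_element \<xi>" "CARD('a) \<ge> 6"
  shows "Q_covers \<xi> (int (CARD('a)))"
  unfolding Q_covers_iff
proof (rule covers_off_conic_and_axis_if_conic_subset[OF _ assms(2)])
  fix t :: 'a assume "t \<noteq> 0"
  then have "t \<in> (\<lambda>k. \<xi> ^ k) ` {..<CARD('a) - 1}"
    using bij_betw_imp_surj_on[OF bij_betw_primitive_element_power[OF assms(1)]] by simp
  then show "conic_point t \<in> Q_set \<xi> (int (CARD('a)))"
    unfolding Q_set_def conic_part_of_nat initial_powers_def by auto
qed

lemma Least_int_eq_of_nat_Least:
  fixes P :: "int \<Rightarrow> bool"
  assumes "P k" "\<And>j. P j \<Longrightarrow> 0 \<le> j"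
  shows "(LEAST j. P j) = int (LEAST n. P (int n))"
proof (rule Least_equality)
  have "P (int (nat k))" using assms by simp
  then show "P (int (LEAST n. P (int n)))" by (rule LeastI)
  show "int (LEAST n. P (int n)) \<le> j" if "P j" for j
    using that assms(2)[OF that] Least_le[of "\<lambda>n. P (int n)" "nat j"] by simp
qed

lemma Q_covers_Jbar:
  fixes \<xi> :: "'a::{field,finite}"
  assumes "primitive_element \<xi>" "CARD('a) \<ge> 6"
  shows "Q_covers \<xi> (Jbar \<xi>)"
proof -
  note Q_covers_CARD[OF assms]
  moreover from this have "Jbar \<xi> = int (LEAST n. Q_covers \<xi> (int n))"
    unfolding Jbar_def by (rule Least_int_eq_of_nat_Least) (rule Q_covers_imp_nonneg)
  ultimately show ?thesis by (simp add: LeastI[of "\<lambda>n. Q_covers \<xi> (int n)"])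
qed

theorem theorem21:
  fixes \<xi> :: "'a::{field,finite}" and q :: nat and J :: int
  assumes "q = CARD('a)"
    and "q \<ge> 27"
    and "q mod 4 = 3"
    and "primitive_element \<xi>"
    and "real_of_int (Jbar \<xi>) \<le> (real q - 3) / 2"
    and "max (real_of_int (Jbar \<xi>)) ((real q - 3) / 4) \<le> real_of_int J"
    and "real_of_int J \<le> (real q - 3) / 2"
  shows "complete_arc (E_set \<xi> J)"
proof -
  define h j where "h = q div 2" and "j = nat J"
  have q: "q = 2 * h + 1" and "odd h" using assms(3) unfolding h_def by presburger+
  have card: "CARD('a) = 2 * h + 1" using assms(1) q by simp
  have "int h - 1 \<le> 2 * J" "J < int h" "Jbar \<xi> \<le> J" using assms(6,7) q by simp_all
  then have J: "J = int j" and j: "0 < j" "j < h" "h \<le> 2 * j + 1"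
    using assms(2) q unfolding j_def by linarith+
  have "covers_off_conic_and_axis (E_set \<xi> J)"
    using Q_covers_Jbar[OF assms(4)] Q_set_subset_E_set[OF \<open>Jbar \<xi> \<le> J\<close>] assms(1,2)
    by (auto simp: Q_covers_iff intro: covers_off_conic_and_axis_mono)
  then show ?thesis
    unfolding J E_set_of_nat
    by (rule complete_arc_conic_extension_initial_powers[OF assms(4) card \<open>odd h\<close> j])
qed

end
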